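(* Let $q$ be a prime power and let $m>1$ be an integer with $\gcd(m,q-1)=1$. Put $n=(q^m-1)/(q-1)$, and let $\{C_h\}_{h=0}^{n}$ denote the weight distribution of the $q$-ary Hamming code $H(m,q)$, i.e. $C_h$ is the number of codewords of Hamming weight $h$ in $H(m,q)$. Then, for every integer $h$ with $1\leq h\leq n$, $$h!\,C_h=(-1)^h q^{m(h-1)}(q^m-1)+\sum_{i=0}^{h-1}(-1)^{h+i-1}C_i\sum_{t=i}^{h}t!\,S(h,t)\,q^{h-t}(q-1)^{t-i}\binom{n-i}{n-t},$$ where $S(h,t)$ denotes the Stirling number of the second kind, defined by $$S(h,t)=\frac{1}{t!}\sum_{j=0}^{t}(-1)^{t-j}\binom{t}{j}j^h .$$
   Context: The $q$-ary Hamming code $H(m,q)$ is the $[n,\,n-m,\,3]$ linear code over $\mathbb{F}_q$, with $n=(q^m-1)/(q-1)$, having as parity check matrix an $m\times n$ matrix whose columns consist of exactly one nonzero vector from each one-dimensional subspace of $\mathbb{F}_q^m$. It is determined up to monomial equivalence, so its weight distribution is well defined. When $\gcd(m,q-1)=1$ it is equivalent to the cyclic code of length $n$ over $\mathbb{F}_q$ with defining zero $\gamma^{q-1}$, where $\gamma$ is a primitive element of $\mathbb{F}_{q^m}$. *)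

theory Defs
  imports "HOL-Analysis.Cartesian_Space"
begin

definition hamming_weight :: "'a::zero ^ 'n \<Rightarrow> nat" where
  "hamming_weight c = card {i. c $ i \<noteq> 0}"

definition weight_distribution :: "('a::zero ^ 'n) set \<Rightarrow> nat \<Rightarrow> nat" where
  "weight_distribution \<C> h = card {c \<in> \<C>. hamming_weight c = h}"

definition code_of_parity_check :: "'a::field ^ 'n ^ 'm \<Rightarrow> ('a ^ 'n) set" where
  "code_of_parity_check H = {c. H *v c = 0}"

definition hamming_parity_check :: "'a::{field,finite} ^ 'n ^ 'm \<Rightarrow> bool" where
  "hamming_parity_check H \<longleftrightarrow>
     (\<forall>j. column j H \<noteq> 0) \<and>
     (\<forall>L. vec.subspace L \<and> vec.dim L = 1 \<longrightarrow> (\<exists>!j. column j H \<in> L))"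

text \<open>The Hamming code is only determined up to monomial equivalence, so being one is
  a predicate: any choice of representatives of the one-dimensional subspaces, in any
  order of the columns, is admitted.\<close>

definition is_hamming_code :: "'m::finite itself \<Rightarrow> ('a::{field,finite} ^ 'n) set \<Rightarrow> bool" where
  "is_hamming_code _ \<C> \<longleftrightarrow>
     (\<exists>H :: 'a ^ 'n ^ 'm. hamming_parity_check H \<and> \<C> = code_of_parity_check H)"

definition stirling2 :: "nat \<Rightarrow> nat \<Rightarrow> real" where
  "stirling2 h t =
     1 / fact t * (\<Sum>j = 0..t. (-1) ^ (t - j) * real (t choose j) * real j ^ h)"

end

theory Submission
  imports Defs
begin

text \<open>The words \<open>x v* H\<close> form the dual (simplex) code, in which every nonzero word has weight
  \<open>q ^ (m - 1)\<close>. The recurrence is therefore the Pless power moment identity, which expresses the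
  \<open>h\<close>-th moment of the dual weights by \<open>C 0, \<dots>, C h\<close>, solved for \<open>C h\<close>. The Pless identity holds
  for any parity check matrix: words of the dual vanishing on a coordinate set \<open>U\<close> and codewords
  supported in \<open>U\<close> are related by double counting, inclusion--exclusion turns this into the
  binomial moments of the dual weights, and Stirling numbers turn those into power moments.\<close>

section \<open>Supports and hyperplanes in coordinate subspaces\<close>

definition supp :: "'a::zero ^ 'n \<Rightarrow> 'n set" where
  "supp c = {i. c $ i \<noteq> 0}"

lemma hamming_weight_eq_card_supp: "hamming_weight c = card (supp c)"
  by (simp add: hamming_weight_def supp_def)

lemma card_supp_subset:
  "card {c :: 'a::{zero,finite} ^ 'n. supp c \<subseteq> T} = CARD('a) ^ card T"
proof -
  have "bij_betw (\<lambda>f. \<chi> i. if i \<in> T then f i else 0) (T \<rightarrow>\<^sub>E UNIV)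
          {c :: 'a ^ 'n. supp c \<subseteq> T}"
    by (rule bij_betw_byWitness[where f' = "\<lambda>c. restrict (($) c) T"])
       (auto simp: supp_def vec_eq_iff PiE_def extensional_def fun_eq_iff split: if_splits)
  from bij_betw_same_card[OF this] show ?thesis
    by (simp add: card_funcsetE)
qed

text \<open>Changing coordinate \<open>j\<close> alone moves the linear form through every field
  element exactly once, so the words supported in \<open>T\<close> split into \<open>q\<close>
  translates of the hyperplane. The product form avoids the truncated exponent
  \<open>card T - 1\<close>.\<close>

lemma card_hyperplane:
  fixes u :: "'a::{field,finite} ^ 'n"
  assumes j: "j \<in> T" "u $ j \<noteq> 0"
  shows "CARD('a) * card {c. supp c \<subseteq> T \<and> (\<Sum>i\<in>UNIV. u $ i * c $ i) = 0} = CARD('a) ^ card T"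
proof -
  define d where "d c = (\<Sum>i\<in>UNIV. u $ i * c $ i)" for c
  define K where "K = {c. supp c \<subseteq> T \<and> d c = 0}"
  define s where "s a c = (\<chi> i. if i = j then c $ i + a else c $ i)" for a and c :: "'a ^ 'n"
  have d_s: "d (s a c) = d c + u $ j * a" for a c
  proof -
    have "d (s a c) = (\<Sum>i\<in>UNIV. u $ i * c $ i + (if i = j then u $ j * a else 0))"
      unfolding d_def s_def by (intro sum.cong) (auto simp: algebra_simps)
    then show ?thesis
      by (simp add: sum.distrib d_def)
  qed
  have s_s: "s a (s b c) = s (a + b) c" "s 0 c = c" for a b c
    by (auto simp: s_def vec_eq_iff)
  have supp_s: "supp (s a c) \<subseteq> T" if "supp c \<subseteq> T" for a c
    using that j by (auto simp: supp_def s_def split: if_splits)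
  have "bij_betw (\<lambda>(a, c). s a c) (UNIV \<times> K) {c. supp c \<subseteq> T}"
    \<comment> \<open>The shift \<open>d c / u $ j\<close> is the one that carries a hyperplane word
      to \<open>c\<close>; undoing it makes the form vanish, by \<open>d_s\<close>.\<close>
    by (rule bij_betw_byWitness[where f' = "\<lambda>c. (d c / u $ j, s (- (d c / u $ j)) c)"])
       (use j in \<open>auto simp: K_def d_s s_s intro: subsetD[OF supp_s]\<close>)
  from bij_betw_same_card[OF this] show ?thesis
    by (simp add: card_cartesian_product K_def d_def card_supp_subset)
qed

text \<open>Merges the case where the form vanishes on \<open>T\<close> and the case where it does
  not, so that the count can be summed over \<open>u\<close> without a case split.\<close>

lemma card_hyperplane_of_bool:
  fixes u :: "'a::{field,finite} ^ 'n"
  shows "real CARD('a) * (\<Sum>c | supp c \<subseteq> T. of_bool ((\<Sum>i\<in>UNIV. u $ i * c $ i) = 0)) =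
    real CARD('a) ^ card T * (1 + (real CARD('a) - 1) * of_bool (\<forall>j\<in>T. u $ j = 0))"
proof -
  have eq: "(\<Sum>c | supp c \<subseteq> T. of_bool ((\<Sum>i\<in>UNIV. u $ i * c $ i) = 0)) =
      real (card {c. supp c \<subseteq> T \<and> (\<Sum>i\<in>UNIV. u $ i * c $ i) = 0})"
    by (simp add: sum.inter_filter[symmetric] of_bool_def Int_def)
  show ?thesis
  proof (cases "\<forall>j\<in>T. u $ j = 0")
    case True
    then have "(\<Sum>i\<in>UNIV. u $ i * c $ i) = 0" if "supp c \<subseteq> T" for c
      using that by (intro sum.neutral) (auto simp: supp_def)
    then have "{c. supp c \<subseteq> T \<and> (\<Sum>i\<in>UNIV. u $ i * c $ i) = 0} = {c. supp c \<subseteq> T}"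
      by auto
    with True show ?thesis
      unfolding eq by (simp add: card_supp_subset)
  next
    case False
    then obtain j where "j \<in> T" "u $ j \<noteq> 0"
      by auto
    with card_hyperplane[OF this] False show ?thesis
      unfolding eq by (simp flip: of_nat_mult of_nat_power)
  qed
qed

section \<open>Double counting of row words against codewords\<close>

text \<open>The same scalar is a linear form in \<open>c\<close> and a linear form in
  \<open>x\<close>, so hyperplanes can be counted in either variable.\<close>

lemma sum_vector_matrix_mult:
  fixes H :: "'a::comm_semiring_1 ^ 'n ^ 'm"
  shows "(\<Sum>j\<in>UNIV. (x v* H) $ j * c $ j) = (\<Sum>i\<in>UNIV. (H *v c) $ i * x $ i)"
  unfolding vector_matrix_mult_def matrix_vector_mult_def
  by (simp add: sum_distrib_left sum_distrib_right mult_ac) (rule sum.swap)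

text \<open>Both sides arise by counting the pairs \<open>(x, c)\<close> with \<open>supp c \<subseteq> U\<close> and \<open>x H c = 0\<close>, over
  \<open>c\<close> first or over \<open>x\<close> first.\<close>

lemma card_row_words_zero_on:
  fixes H :: "'a::{field,finite} ^ 'n ^ 'm"
  shows "real CARD('a) ^ card U * (\<Sum>x\<in>UNIV. of_bool (\<forall>j\<in>U. (x v* H) $ j = 0)) =
    real CARD('a) ^ CARD('m) * (\<Sum>c | supp c \<subseteq> U. of_bool (H *v c = 0))"
    (is "?q ^ _ * ?A = _ * ?B")
proof -
  have "CARD('a) \<ge> card {0, 1 :: 'a}"
    by (intro card_mono) auto
  then have q: "?q > 1"
    by simp
  let ?N = "\<Sum>x\<in>UNIV. \<Sum>c | supp c \<subseteq> U. of_bool ((\<Sum>j\<in>UNIV. (x v* H) $ j * c $ j) = 0) :: real"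
  have "?q * ?N = (\<Sum>x\<in>UNIV. ?q ^ card U * (1 + (?q - 1) * of_bool (\<forall>j\<in>U. (x v* H) $ j = 0)))"
    unfolding card_hyperplane_of_bool[symmetric] by (rule sum_distrib_left)
  then have "?q * ?N = ?q ^ card U * (?q ^ CARD('m) + (?q - 1) * ?A)"
    by (simp add: sum.distrib del: sum_of_bool_eq flip: sum_distrib_left)
  \<comment> \<open>The trivial restriction \<open>supp x \<subseteq> UNIV\<close> brings the sum
    over \<open>x\<close> into the shape of the hyperplane count, now with \<open>H *v c\<close> as
    the form.\<close>
  moreover have "?N = (\<Sum>c | supp c \<subseteq> U. \<Sum>x | supp x \<subseteq> UNIV. of_bool ((\<Sum>i\<in>UNIV. (H *v c) $ i * x $ i) = 0))"
    unfolding sum_vector_matrix_mult by (subst sum.swap) simp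
  then have "?q * ?N = (\<Sum>c | supp c \<subseteq> U. ?q ^ CARD('m) * (1 + (?q - 1) * of_bool (\<forall>i\<in>UNIV. (H *v c) $ i = 0)))"
    unfolding card_hyperplane_of_bool[symmetric] by (simp only: sum_distrib_left)
  then have "?q * ?N = ?q ^ CARD('m) * (?q ^ card U + (?q - 1) * ?B)"
    by (simp add: sum.distrib card_supp_subset vec_eq_iff del: sum_of_bool_eq flip: sum_distrib_left)
  \<comment> \<open>The two evaluations share the summand \<open>q ^ card U * q ^ m\<close>, which
    cancels; the remaining factor \<open>q - 1\<close> is nonzero because \<open>0\<close> and
    \<open>1\<close> differ in a field.\<close>
  ultimately have "(?q - 1) * (?q ^ card U * ?A) = (?q - 1) * (?q ^ CARD('m) * ?B)"
    by (simp add: algebra_simps)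
  with q show ?thesis
    by simp
qed

section \<open>Inclusion-exclusion over coordinate sets\<close>

text \<open>The sum factors over the elements of \<open>T\<close>: those of \<open>D\<close> must
  lie in \<open>U\<close> and give \<open>-z\<close>, the others are free and give
  \<open>1 - z\<close>.\<close>

lemma sum_between_minus_power:
  fixes z :: real
  assumes "finite T" "D \<subseteq> T"
  shows "(\<Sum>U\<in>Pow T. (-z) ^ card U * of_bool (D \<subseteq> U)) = (-z) ^ card D * (1 - z) ^ (card T - card D)"
proof -
  have fin: "finite X" if "X \<subseteq> T" for X
    using that assms(1) finite_subset by auto
  have "(-z) ^ card U * of_bool (D \<subseteq> U) = (\<Prod>x\<in>U. -z) * (\<Prod>x\<in>T - U. of_bool (x \<notin> D))" if "U \<in> Pow T" for U
  proof (cases "D \<subseteq> U")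
    case False
    then obtain x where "x \<in> D" "x \<notin> U" by auto
    with assms have "(\<Prod>x\<in>T - U. of_bool (x \<notin> D)) = (0 :: real)"
      by (intro prod_zero) auto
    with False show ?thesis by simp
  next
    case True
    then have "(\<Prod>x\<in>T - U. of_bool (x \<notin> D)) = (1 :: real)"
      by (intro prod.neutral) auto
    with True show ?thesis by simp
  qed
  then have "(\<Sum>U\<in>Pow T. (-z) ^ card U * of_bool (D \<subseteq> U)) = (\<Prod>x\<in>T. -z + of_bool (x \<notin> D))"
    unfolding prod_add[OF assms(1)] by (rule sum.cong[OF refl])
  also have "\<dots> = (\<Prod>x\<in>D. -z + of_bool (x \<notin> D)) * (\<Prod>x\<in>T - D. -z + of_bool (x \<notin> D))"
    using assms by (simp add: prod.subset_diff mult.commute)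
  also have "\<dots> = (\<Prod>x\<in>D. -z) * (\<Prod>x\<in>T - D. 1 - z)"
    by (intro arg_cong2[where f = "(*)"] prod.cong) auto
  finally show ?thesis
    using assms by (simp add: card_Diff_subset fin)
qed

text \<open>Inclusion-exclusion over the sets \<open>U\<close> of zeros within \<open>T\<close>,
  with double counting applied to each \<open>U\<close>. Words are counted by message
  \<open>x\<close>, so \<open>q ^ m\<close> is the right total whatever the rank of
  \<open>H\<close>.\<close>

lemma card_row_words_nonzero_on:
  fixes H :: "'a::{field,finite} ^ 'n ^ 'm"
  shows "(\<Sum>x\<in>UNIV. of_bool (T \<subseteq> supp (x v* H))) =
    real CARD('a) ^ CARD('m) / real CARD('a) ^ card T *
    (\<Sum>c | H *v c = 0 \<and> supp c \<subseteq> T.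
      (-1) ^ hamming_weight c * (real CARD('a) - 1) ^ (card T - hamming_weight c))"
    (is "_ = ?qm / ?q ^ _ * _")
proof -
  have q: "?q > 0"
    by simp
  \<comment> \<open>Expands the product of \<open>1 - of_bool (v $ j = 0)\<close> over
    \<open>j\<close> in \<open>T\<close>.\<close>
  have incl_excl: "of_bool (T \<subseteq> supp v) = (\<Sum>U\<in>Pow T. (-1) ^ card U * of_bool (\<forall>j\<in>U. v $ j = 0) :: real)"
    for v :: "'a ^ 'n"
  proof -
    have "of_bool (T \<subseteq> supp v) = (\<Prod>j\<in>T. - of_bool (v $ j = 0) + 1 :: real)"
    proof (cases "T \<subseteq> supp v")
      case True
      then show ?thesis
        by (intro trans[OF _ prod.neutral[symmetric]]) (auto simp: supp_def)
    next
      case False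
      then show ?thesis
        by (auto simp: supp_def intro!: prod_zero[symmetric])
    qed
    also have "\<dots> = (\<Sum>U\<in>Pow T. \<Prod>j\<in>U. - of_bool (v $ j = 0))"
      by (subst prod_add) simp_all
    also have "\<dots> = (\<Sum>U\<in>Pow T. (-1) ^ card U * of_bool (\<forall>j\<in>U. v $ j = 0))"
    proof (intro sum.cong refl)
      fix U
      have "(\<Prod>j\<in>U. of_bool (v $ j = 0) :: real) = of_bool (\<forall>j\<in>U. v $ j = 0)"
        by (induction U rule: infinite_finite_induct) auto
      then show "(\<Prod>j\<in>U. - of_bool (v $ j = 0) :: real) = (-1) ^ card U * of_bool (\<forall>j\<in>U. v $ j = 0)"
        by (simp only: prod_uminus)
    qed
    finally show ?thesis .
  qed
  have "(\<Sum>x\<in>UNIV. of_bool (T \<subseteq> supp (x v* H))) =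
      (\<Sum>U\<in>Pow T. (-1) ^ card U * (\<Sum>x\<in>UNIV. of_bool (\<forall>j\<in>U. (x v* H) $ j = 0)) :: real)"
    unfolding incl_excl by (subst sum.swap) (simp only: sum_distrib_left)
  also have "\<dots> = (\<Sum>U\<in>Pow T. ?qm * ((- (1 / ?q)) ^ card U * (\<Sum>c | supp c \<subseteq> U. of_bool (H *v c = 0))))"
  proof (intro sum.cong refl)
    fix U
    have "(\<Sum>x\<in>UNIV. of_bool (\<forall>j\<in>U. (x v* H) $ j = 0)) =
        ?qm / ?q ^ card U * (\<Sum>c | supp c \<subseteq> U. of_bool (H *v c = 0))"
      using card_row_words_zero_on[where H = H and U = U] q by (simp add: field_simps)
    then show "(-1) ^ card U * (\<Sum>x\<in>UNIV. of_bool (\<forall>j\<in>U. (x v* H) $ j = 0)) =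
        ?qm * ((- (1 / ?q)) ^ card U * (\<Sum>c | supp c \<subseteq> U. of_bool (H *v c = 0)))"
      by (simp add: power_minus[of "1 / ?q"] power_divide)
  qed
  \<comment> \<open>With codewords in \<open>T\<close> as a fixed range, \<open>U\<close> runs
    between \<open>supp c\<close> and \<open>T\<close>, which is the sum evaluated above at
    \<open>z = 1 / q\<close>.\<close>
  also have "\<dots> = ?qm * (\<Sum>U\<in>Pow T. \<Sum>c | H *v c = 0 \<and> supp c \<subseteq> T. (- (1 / ?q)) ^ card U * of_bool (supp c \<subseteq> U))"
    unfolding sum_distrib_left[of ?qm, symmetric]
  proof (intro arg_cong[where f = "(*) ?qm"] sum.cong refl)
    fix U assume "U \<in> Pow T"
    then have "(\<Sum>c | supp c \<subseteq> U. of_bool (H *v c = 0)) =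
        (\<Sum>c | H *v c = 0 \<and> supp c \<subseteq> T. of_bool (supp c \<subseteq> U) :: real)"
      by (simp add: Int_def) (intro arg_cong[where f = card], auto)
    then show "(- (1 / ?q)) ^ card U * (\<Sum>c | supp c \<subseteq> U. of_bool (H *v c = 0)) =
        (\<Sum>c | H *v c = 0 \<and> supp c \<subseteq> T. (- (1 / ?q)) ^ card U * of_bool (supp c \<subseteq> U))"
      by (simp add: sum_distrib_left)
  qed
  also have "\<dots> = ?qm * (\<Sum>c | H *v c = 0 \<and> supp c \<subseteq> T. (- (1 / ?q)) ^ card (supp c) * (1 - 1 / ?q) ^ (card T - card (supp c)))"
    by (subst sum.swap) (intro arg_cong[where f = "(*) ?qm"] sum.cong refl sum_between_minus_power, auto)
  also have "\<dots> = ?qm / ?q ^ card T * (\<Sum>c | H *v c = 0 \<and> supp c \<subseteq> T.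
      (-1) ^ hamming_weight c * (?q - 1) ^ (card T - hamming_weight c))"
    unfolding sum_distrib_left
  proof (intro sum.cong refl)
    fix c assume "c \<in> {c. H *v c = 0 \<and> supp c \<subseteq> T}"
    then have "card (supp c) \<le> card T"
      by (intro card_mono) auto
    then obtain k where "card T = card (supp c) + k"
      using le_Suc_ex by blast
    moreover have "1 - 1 / ?q = (?q - 1) / ?q"
      by (simp add: field_simps)
    ultimately show "?qm * ((- (1 / ?q)) ^ card (supp c) * (1 - 1 / ?q) ^ (card T - card (supp c))) =
        ?qm / ?q ^ card T * ((-1) ^ hamming_weight c * (?q - 1) ^ (card T - hamming_weight c))"
      by (simp add: hamming_weight_eq_card_supp power_minus[of "1 / ?q"] power_divide power_add)
  qed
  finally show ?thesis .
qed

section \<open>Binomial moments of the row word weights\<close>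

lemma card_uminus_set: "card (- A) = CARD('n) - card A" for A :: "'n::finite set"
  by (simp add: Compl_eq_Diff_UNIV card_Diff_subset)

text \<open>Complements of the sets counted are the subsets of \<open>- D\<close> of size
  \<open>CARD('n) - t\<close>. If \<open>D\<close> has more than \<open>t\<close> elements, both
  sides are zero.\<close>

lemma card_supersets:
  fixes D :: "'n::finite set"
  assumes "t \<le> CARD('n)"
  shows "card {T. card T = t \<and> D \<subseteq> T} = (CARD('n) - card D) choose (CARD('n) - t)"
proof -
  have "bij_betw uminus {T. card T = t \<and> D \<subseteq> T} {S. S \<subseteq> - D \<and> card S = CARD('n) - t}"
    by (rule bij_betw_byWitness[where f' = uminus]) (use assms in \<open>auto simp: card_uminus_set card_mono\<close>)
  from bij_betw_same_card[OF this] show ?thesis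
    by (simp add: n_subsets card_uminus_set)
qed

text \<open>The binomial coefficient counts the \<open>t\<close>-subsets of a support. Summing the
  previous count over all \<open>T\<close> of size \<open>t\<close>, a codeword of weight
  \<open>i\<close> occurs once for each such \<open>T\<close> containing its support.\<close>

lemma sum_choose_hamming_weight:
  fixes H :: "'a::{field,finite} ^ 'n ^ 'm"
  assumes t: "t \<le> CARD('n)"
  shows "(\<Sum>x\<in>UNIV. real (hamming_weight (x v* H) choose t)) =
    real CARD('a) ^ CARD('m) / real CARD('a) ^ t *
    (\<Sum>i=0..t. (-1) ^ i * real (weight_distribution (code_of_parity_check H) i) *
      (real CARD('a) - 1) ^ (t - i) * real ((CARD('n) - i) choose (CARD('n) - t)))"
    (is "_ = ?qm / ?q ^ _ * _")
proof -
  let ?w = "\<lambda>c::'a^'n. (-1) ^ hamming_weight c * (?q - 1) ^ (t - hamming_weight c)"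
  let ?b = "\<lambda>i. real ((CARD('n) - i) choose (CARD('n) - t))"
  have "real (hamming_weight v choose t) = (\<Sum>T | card T = t. of_bool (T \<subseteq> supp v))" for v :: "'a ^ 'n"
    using n_subsets[of "supp v" t] by (simp add: hamming_weight_eq_card_supp Int_def conj_commute)
  then have "(\<Sum>x\<in>UNIV. real (hamming_weight (x v* H) choose t)) =
      (\<Sum>T | card T = t. \<Sum>x\<in>UNIV. of_bool (T \<subseteq> supp (x v* H)))"
    by (simp only:) (rule sum.swap)
  also have "\<dots> = ?qm / ?q ^ t * (\<Sum>T | card T = t. \<Sum>c | H *v c = 0 \<and> supp c \<subseteq> T. ?w c)"
    by (simp add: card_row_words_nonzero_on sum_distrib_left)
  also have "(\<Sum>T | card T = t. \<Sum>c | H *v c = 0 \<and> supp c \<subseteq> T. ?w c) =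
      (\<Sum>T | card T = t. \<Sum>c | H *v c = 0. ?w c * of_bool (supp c \<subseteq> T))"
    by (intro sum.cong refl sum.mono_neutral_cong_left) auto
  also have "\<dots> = (\<Sum>c | H *v c = 0. ?w c * (\<Sum>T | card T = t. of_bool (supp c \<subseteq> T)))"
    by (subst sum.swap) (simp only: sum_distrib_left)
  also have "\<dots> = (\<Sum>c | H *v c = 0. ?w c * ?b (hamming_weight c))"
    using card_supersets[OF t]
    by (simp add: Int_def hamming_weight_eq_card_supp)
  \<comment> \<open>A codeword heavier than \<open>t\<close> fits into no \<open>T\<close> of size
    \<open>t\<close>; its binomial coefficient is zero, as \<open>CARD('n) - t\<close> exceeds its
    upper index.\<close>
  also have "\<dots> = (\<Sum>c\<in>{c. H *v c = 0 \<and> hamming_weight c \<le> t}. ?w c * ?b (hamming_weight c))"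
  proof (rule sum.mono_neutral_right, goal_cases)
    case 3
    have "?b (hamming_weight c) = 0" if "t < hamming_weight c" for c :: "'a ^ 'n"
    proof -
      have "hamming_weight c \<le> CARD('n)"
        unfolding hamming_weight_def by (rule card_mono) auto
      with that show ?thesis
        by (simp add: binomial_eq_0)
    qed
    then have "t < hamming_weight c \<Longrightarrow> ?w c * ?b (hamming_weight c) = 0" for c
      by (simp only: mult_zero_right)
    then show ?case
      by (intro ballI) (metis (lifting) DiffE mem_Collect_eq not_le)
  qed auto
  also have "\<dots> = (\<Sum>i=0..t. \<Sum>c\<in>{c \<in> {c. H *v c = 0 \<and> hamming_weight c \<le> t}. hamming_weight c = i}. ?w c * ?b (hamming_weight c))"
    by (rule sum.group[symmetric]) auto
  also have "\<dots> = (\<Sum>i=0..t. (-1) ^ i * real (weight_distribution (code_of_parity_check H) i) *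
      (?q - 1) ^ (t - i) * ?b i)"
  proof (intro sum.cong refl)
    fix i assume "i \<in> {0..t}"
    then have "{c \<in> {c. H *v c = 0 \<and> hamming_weight c \<le> t}. hamming_weight c = i} =
        {c \<in> code_of_parity_check H. hamming_weight c = i}"
      by (auto simp: code_of_parity_check_def)
    then show "(\<Sum>c\<in>{c \<in> {c. H *v c = 0 \<and> hamming_weight c \<le> t}. hamming_weight c = i}. ?w c * ?b (hamming_weight c)) =
        (-1) ^ i * real (weight_distribution (code_of_parity_check H) i) * (?q - 1) ^ (t - i) * ?b i"
      by (simp add: weight_distribution_def)
  qed
  finally show ?thesis .
qed

section \<open>Stirling numbers of the second kind\<close>

lemma fact_stirling2: "fact t * stirling2 h t = (\<Sum>j = 0..t. (-1) ^ (t - j) * real (t choose j) * real j ^ h)"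
  by (simp add: stirling2_def)

text \<open>The recurrence for surjection numbers \<open>fact t * stirling2 h t\<close>, in which
  the division by \<open>fact t\<close> disappears. It holds term by term in the alternating
  sums.\<close>

lemma fact_stirling2_Suc_Suc:
  "fact (Suc t) * stirling2 (Suc h) (Suc t) =
     real (Suc t) * (fact (Suc t) * stirling2 h (Suc t) + fact t * stirling2 h t)"
proof -
  \<comment> \<open>The factor \<open>of_bool (j \<le> t)\<close> extends the sum for
    \<open>t\<close> to the range of the sum for \<open>Suc t\<close>.\<close>
  have "(-1) ^ (Suc t - j) * real (Suc t choose j) * real j ^ Suc h =
    real (Suc t) * ((-1) ^ (Suc t - j) * real (Suc t choose j) * real j ^ h +
      of_bool (j \<le> t) * ((-1) ^ (t - j) * real (t choose j) * real j ^ h))"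
    if "j \<le> Suc t" for j
  proof (cases "j \<le> t")
    case True
    have "(Suc t - j) * (Suc t choose j) = Suc t * (t choose j)"
      using binomial_absorb_comp[of "Suc t" j] by simp
    then have "real j * real (Suc t choose j) = real (Suc t) * (real (Suc t choose j) - real (t choose j))"
      using True by (simp only: of_nat_diff of_nat_mult flip: of_nat_eq_iff[where 'a = real])
        (simp add: algebra_simps of_nat_diff)
    then have "(-1) ^ (Suc t - j) * real j ^ h * (real j * real (Suc t choose j)) =
        (-1) ^ (Suc t - j) * real j ^ h * (real (Suc t) * (real (Suc t choose j) - real (t choose j)))"
      by simp
    with True show ?thesis
      by (simp add: Suc_diff_le algebra_simps)
  next
    case False
    with that have "j = Suc t"
      by simp
    then show ?thesis
      by simp
  qed
  then have "fact (Suc t) * stirling2 (Suc h) (Suc t) = real (Suc t) *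
      (fact (Suc t) * stirling2 h (Suc t) +
       (\<Sum>j=0..Suc t. of_bool (j \<le> t) * ((-1) ^ (t - j) * real (t choose j) * real j ^ h)))"
    unfolding fact_stirling2 by (simp only: sum_distrib_left sum.distrib[symmetric]) (rule sum.cong[OF refl], simp only: atLeastAtMost_iff)
  also have "(\<Sum>j=0..Suc t. of_bool (j \<le> t) * ((-1) ^ (t - j) * real (t choose j) * real j ^ h)) =
      fact t * stirling2 h t"
    unfolding fact_stirling2 by simp
  finally show ?thesis .
qed

lemma stirling2_Suc_0: "stirling2 (Suc h) 0 = 0"
  by (simp add: stirling2_def)

text \<open>At exponent zero only the alternating sum of a full binomial row is left, and it
  vanishes.\<close>

lemma stirling2_0_Suc: "stirling2 0 (Suc t) = 0"
proof -
  have "fact (Suc t) * stirling2 0 (Suc t) = (\<Sum>j\<le>Suc t. (-1) ^ (Suc t + j) * real (Suc t choose j))"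
    unfolding fact_stirling2
    by (intro sum.cong) (auto simp: minus_one_power_iff)
  also have "\<dots> = (-1) ^ Suc t * (\<Sum>j\<le>Suc t. (-1) ^ j * real (Suc t choose j))"
    by (simp only: sum_distrib_left power_add mult.assoc)
  also have "\<dots> = 0"
    by (subst choose_alternating_sum) auto
  finally show ?thesis
    by simp
qed

lemma stirling2_eq_0: "h < t \<Longrightarrow> stirling2 h t = 0"
proof (induction h arbitrary: t)
  case 0
  then show ?case
    using stirling2_0_Suc gr0_conv_Suc by auto
next
  case (Suc h)
  then obtain t' where "t = Suc t'" "h < t'"
    using Suc_lessE by blast
  with Suc.IH[of t] Suc.IH[of t'] fact_stirling2_Suc_Suc[of t' h] show ?case
    by simp
qed

lemma stirling2_diag: "stirling2 h h = 1"
proof (induction h)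
  case (Suc h)
  then show ?case
    using fact_stirling2_Suc_Suc[of h h] by (simp add: stirling2_eq_0 del: of_nat_Suc)
qed (simp add: stirling2_def)

text \<open>Expands powers in the binomial basis, turning binomial moments into power moments.
  Multiplying by \<open>k\<close> acts on that basis by \<open>absorb\<close>, which matches the
  recurrence for surjection numbers.\<close>

lemma power_eq_sum_stirling2:
  "real k ^ h = (\<Sum>t=0..h. fact t * stirling2 h t * real (k choose t))"
proof (induction h)
  case 0
  then show ?case by (simp add: stirling2_def)
next
  case (Suc h)
  define F where "F h t = fact t * stirling2 h t" for h t
  have absorb: "real k * real (k choose t) = real t * real (k choose t) + real (Suc t) * real (k choose Suc t)" for t
    using arg_cong[OF Suc_times_binomial[of t k], of real] by (simp add: algebra_simps)
  have "real k ^ Suc h = (\<Sum>t=0..h. F h t * (real k * real (k choose t)))"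
    unfolding F_def by (simp add: Suc.IH sum_distrib_left mult_ac)
  also have "\<dots> = (\<Sum>t=0..h. real t * F h t * real (k choose t)) +
      (\<Sum>t=0..h. real (Suc t) * F h t * real (k choose Suc t))"
    unfolding absorb by (simp add: algebra_simps sum.distrib)
  \<comment> \<open>The added term at \<open>Suc h\<close> vanishes since
    \<open>stirling2 h (Suc h) = 0\<close>; the term at \<open>0\<close> then drops out in the shift
    because of its factor \<open>t\<close>.\<close>
  also have "(\<Sum>t=0..h. real t * F h t * real (k choose t)) = (\<Sum>t=0..Suc h. real t * F h t * real (k choose t))"
    by (simp add: F_def stirling2_eq_0)
  also have "\<dots> = (\<Sum>t=0..h. real (Suc t) * F h (Suc t) * real (k choose Suc t))"
    by (subst sum.atLeast0_atMost_Suc_shift) simp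
  also have "\<dots> + (\<Sum>t=0..h. real (Suc t) * F h t * real (k choose Suc t)) =
      (\<Sum>t=0..h. F (Suc h) (Suc t) * real (k choose Suc t))"
    unfolding F_def fact_stirling2_Suc_Suc
    by (simp only: sum.distrib[symmetric]) (simp only: algebra_simps)
  also have "\<dots> = (\<Sum>t=0..Suc h. F (Suc h) t * real (k choose t))"
    by (subst sum.atLeast0_atMost_Suc_shift) (simp add: F_def stirling2_Suc_0)
  finally show ?case
    unfolding F_def .
qed

section \<open>Constant weight of the simplex code\<close>

text \<open>Each nonzero \<open>y\<close> is a unique nonzero multiple of a unique column, and \<open>x \<bullet> y \<noteq> 0\<close> depends on
  that column only, so the weight times \<open>q - 1\<close> is the number of \<open>y\<close> off the hyperplane \<open>x \<bullet> y = 0\<close>.\<close>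

lemma hamming_weight_row_word:
  fixes H :: "'a::{field,finite} ^ 'n ^ 'm"
  assumes H: "hamming_parity_check H" and x: "x \<noteq> 0"
  shows "hamming_weight (x v* H) = CARD('a) ^ (CARD('m) - 1)"
proof -
  define d where "d y = (\<Sum>i\<in>UNIV. x $ i * y $ i)" for y
  have col_nz: "column j H \<noteq> 0" for j
    using H by (simp add: hamming_parity_check_def)
  have ex1: "\<exists>!j. column j H \<in> vec.span {y}" if "y \<noteq> 0" for y :: "'a ^ 'm"
    using H that unfolding hamming_parity_check_def by (metis vec.subspace_span vec.dim_span vec.dim_singleton)
  have d_scale: "d (a *s y) = a * d y" for a y
    by (simp add: d_def sum_distrib_left mult_ac)
  have d_col: "d (column j H) = (x v* H) $ j" for j
    by (simp add: d_def vector_matrix_mult_def column_def mult_ac)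
  have "bij_betw (\<lambda>(j, a). a *s column j H) (supp (x v* H) \<times> (UNIV - {0})) {y. d y \<noteq> 0}"
    unfolding bij_betw_def
  proof (intro conjI inj_onI equalityI subsetI)
    fix p p' assume p: "p \<in> supp (x v* H) \<times> (UNIV - {0})" "p' \<in> supp (x v* H) \<times> (UNIV - {0})"
      and eq: "(\<lambda>(j, a). a *s column j H) p = (\<lambda>(j, a). a *s column j H) p'"
    obtain j a j' a' where pp: "p = (j, a)" "p' = (j', a')"
      by fastforce
    have nz: "a \<noteq> 0" "a' \<noteq> 0" and eq': "a *s column j H = a' *s column j' H"
      using p eq by (auto simp: pp)
    have "column j H = (a' / a) *s column j' H"
      using arg_cong[OF eq', of "\<lambda>v. (1 / a) *s v"] nz by (simp add: vector_smult_assoc)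
    then have "column j H \<in> vec.span {column j' H}"
      unfolding vec.span_singleton by (rule range_eqI)
    moreover have "column j' H \<in> vec.span {column j' H}"
      by (simp add: vec.span_base)
    ultimately have "j = j'"
      using ex1[OF col_nz] by blast
    with eq' col_nz[of j] show "p = p'"
      by (simp add: pp)
  next
    fix y assume "y \<in> (\<lambda>(j, a). a *s column j H) ` (supp (x v* H) \<times> (UNIV - {0}))"
    then show "y \<in> {y. d y \<noteq> 0}"
      by (auto simp: d_scale d_col supp_def)
  next
    fix y assume "y \<in> {y. d y \<noteq> 0}"
    then have dy: "d y \<noteq> 0" by simp
    then have "y \<noteq> 0"
      by (auto simp: d_def)
    \<comment> \<open>The column representing the line through \<open>y\<close> gives the index, and
      \<open>1 / b\<close> is the scalar leading back to \<open>y\<close>.\<close>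
    then obtain j b where jb: "column j H = b *s y"
      using ex1[of y] by (auto simp: vec.span_singleton)
    with col_nz[of j] have b: "b \<noteq> 0"
      by auto
    have "j \<in> supp (x v* H)"
      using dy b by (simp add: supp_def jb d_scale flip: d_col)
    moreover have "y = (1 / b) *s column j H"
      using b by (simp add: jb vector_smult_assoc)
    ultimately show "y \<in> (\<lambda>(j, a). a *s column j H) ` (supp (x v* H) \<times> (UNIV - {0}))"
      using b by (intro image_eqI[where x = "(j, 1 / b)"]) auto
  qed
  from bij_betw_same_card[OF this]
  have "hamming_weight (x v* H) * (CARD('a) - 1) = card {y. d y \<noteq> 0}"
    by (simp add: card_cartesian_product hamming_weight_eq_card_supp card_Diff_subset)
  also have "\<dots> = CARD('a) ^ CARD('m) - card {y. d y = 0}"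
    using card_uminus_set[of "{y. d y = 0}"] by (simp add: Collect_neg_eq)
  finally have w: "hamming_weight (x v* H) * (CARD('a) - 1) = CARD('a) ^ CARD('m) - card {y. d y = 0}" .
  obtain i where "x $ i \<noteq> 0"
    using x by (auto simp: vec_eq_iff)
  then have "CARD('a) * card {y. d y = 0} = CARD('a) ^ CARD('m)"
    using card_hyperplane[of i UNIV x] by (simp add: d_def)
  moreover have pow: "CARD('a) ^ CARD('m) = CARD('a) * CARD('a) ^ (CARD('m) - 1)"
    by (simp flip: power_Suc)
  ultimately have "card {y. d y = 0} = CARD('a) ^ (CARD('m) - 1)"
    by simp
  then have "hamming_weight (x v* H) * (CARD('a) - 1) = CARD('a) ^ (CARD('m) - 1) * (CARD('a) - 1)"
    unfolding w pow by (simp add: algebra_simps)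
  moreover have "CARD('a) \<ge> card {0, 1 :: 'a}"
    by (intro card_mono) auto
  ultimately show ?thesis
    by simp
qed

section \<open>Power moments and the recurrence\<close>

text \<open>The Pless power moment identity: binomial moments weighted by surjection numbers, with
  the sums over \<open>t\<close> and \<open>i\<close> interchanged. The bound on \<open>h\<close>
  keeps every \<open>t\<close> within the range of the binomial moment formula.\<close>

lemma sum_power_hamming_weight:
  fixes H :: "'a::{field,finite} ^ 'n ^ 'm"
  assumes h: "h \<le> CARD('n)"
  shows "(\<Sum>x\<in>UNIV. real (hamming_weight (x v* H)) ^ h) =
    real CARD('a) ^ CARD('m) / real CARD('a) ^ h *
    (\<Sum>i=0..h. (-1) ^ i * real (weight_distribution (code_of_parity_check H) i) *
      (\<Sum>t=i..h. fact t * stirling2 h t * real CARD('a) ^ (h - t) * (real CARD('a) - 1) ^ (t - i) *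
        real ((CARD('n) - i) choose (CARD('n) - t))))"
    (is "_ = ?qm / ?q ^ _ * _")
proof -
  let ?W = "\<lambda>i. (-1) ^ i * real (weight_distribution (code_of_parity_check H) i)"
  let ?g = "\<lambda>i t. fact t * stirling2 h t * ?q ^ (h - t) * (?q - 1) ^ (t - i) *
    real ((CARD('n) - i) choose (CARD('n) - t))"
  have "(\<Sum>x\<in>UNIV. real (hamming_weight (x v* H)) ^ h) =
      (\<Sum>t=0..h. fact t * stirling2 h t * (\<Sum>x\<in>UNIV. real (hamming_weight (x v* H) choose t)))"
    unfolding power_eq_sum_stirling2 by (subst sum.swap) (simp only: sum_distrib_left)
  also have "\<dots> = (\<Sum>t=0..h. ?qm / ?q ^ h * (\<Sum>i=0..t. ?W i * ?g i t))"
  proof (intro sum.cong refl)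
    fix t assume "t \<in> {0..h}"
    then have t: "t \<le> CARD('n)" and "?qm / ?q ^ t = ?qm / ?q ^ h * ?q ^ (h - t)"
      using h by (auto simp: power_diff)
    then show "fact t * stirling2 h t * (\<Sum>x\<in>UNIV. real (hamming_weight (x v* H) choose t)) =
        ?qm / ?q ^ h * (\<Sum>i=0..t. ?W i * ?g i t)"
      unfolding sum_choose_hamming_weight[OF t] by (simp only: sum_distrib_left mult_ac)
  qed
  also have "\<dots> = ?qm / ?q ^ h * (\<Sum>i=0..h. \<Sum>t=i..h. ?W i * ?g i t)"
  proof -
    have "(\<Sum>t=0..h. \<Sum>i=0..t. ?W i * ?g i t) = (\<Sum>t=0..h. \<Sum>i | i \<in> {0..h} \<and> i \<le> t. ?W i * ?g i t)"
      by (intro sum.cong) auto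
    also have "\<dots> = (\<Sum>i=0..h. \<Sum>t | t \<in> {0..h} \<and> i \<le> t. ?W i * ?g i t)"
      by (rule sum.swap_restrict) auto
    also have "\<dots> = (\<Sum>i=0..h. \<Sum>t=i..h. ?W i * ?g i t)"
      by (intro sum.cong) auto
    finally have "(\<Sum>t=0..h. \<Sum>i=0..t. ?W i * ?g i t) = (\<Sum>i=0..h. \<Sum>t=i..h. ?W i * ?g i t)" .
    then show ?thesis
      by (simp only: sum_distrib_left[symmetric])
  qed
  finally show ?thesis
    by (simp only: sum_distrib_left)
qed

theorem theorem1:
  fixes q m n :: nat
    and \<C> :: "('a::{field,finite} ^ 'n) set"
    and C :: "nat \<Rightarrow> nat"
  assumes "q = CARD('a)"
    and "m = CARD('m::finite)"
    and "m > 1"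
    and "gcd m (q - 1) = 1"
    and "n = (q ^ m - 1) div (q - 1)"
    and "CARD('n) = n"
    and "is_hamming_code TYPE('m) \<C>"
    and "\<And>h. C h = weight_distribution \<C> h"
  shows "\<forall>h \<in> {1..n}.
    fact h * real (C h) =
      (-1) ^ h * real q ^ (m * (h - 1)) * (real q ^ m - 1) +
      (\<Sum>i = 0..h - 1. (-1) ^ (h + i - 1) * real (C i) *
        (\<Sum>t = i..h. fact t * stirling2 h t * real q ^ (h - t) * (real q - 1) ^ (t - i) *
          real ((n - i) choose (n - t))))"
proof
  fix h assume h: "h \<in> {1..n}"
  then obtain k where k: "h = Suc k"
    using not0_implies_Suc by fastforce
  obtain H :: "'a ^ 'n ^ 'm" where H: "hamming_parity_check H" "\<C> = code_of_parity_check H"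
    using assms(7) by (auto simp: is_hamming_code_def)
  define G where "G i = (\<Sum>t = i..h. fact t * stirling2 h t * real q ^ (h - t) * (real q - 1) ^ (t - i) *
    real ((n - i) choose (n - t)))" for i
  define S where "S = (\<Sum>i=0..k. (-1) ^ i * real (C i) * G i)"
  have q: "real q > 0"
    by (simp add: assms(1))
  have diag: "fact h * stirling2 h h = (fact h :: real)"
    by (simp add: stirling2_diag)
  have "(\<Sum>x\<in>UNIV. real (hamming_weight (x v* H)) ^ h) =
      real q ^ m / real q ^ h * (\<Sum>i=0..h. (-1) ^ i * real (C i) * G i)"
    using sum_power_hamming_weight[of h H] h by (simp add: G_def assms(1,2,6,8) H(2))
  \<comment> \<open>Isolates \<open>C h\<close>: for \<open>i = h\<close> the inner sum has the
    single term \<open>t = h\<close>, whose value is \<open>fact h\<close> as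
    \<open>stirling2 h h = 1\<close>.\<close>
  also have "(\<Sum>i=0..h. (-1) ^ i * real (C i) * G i) = S + (-1) ^ h * (fact h * real (C h))"
    using diag by (simp add: k S_def G_def)
  \<comment> \<open>The zero message contributes \<open>0 ^ h\<close>, which is zero because
    \<open>h\<close> is at least 1; all other messages give the same weight.\<close>
  also have "(\<Sum>x\<in>UNIV. real (hamming_weight (x v* H)) ^ h) =
      (\<Sum>x\<in>UNIV - {0}. real (hamming_weight (x v* H)) ^ h)"
    using h by (intro sum.mono_neutral_right) (auto simp: hamming_weight_def)
  also have "\<dots> = (real q ^ m - 1) * real q ^ ((m - 1) * h)"
    using hamming_weight_row_word[OF H(1)]
    by (simp add: assms(1,2) card_Diff_subset of_nat_diff power_mult)
  finally have "(real q ^ m - 1) * (real q ^ ((m - 1) * h) * real q ^ h) =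
      real q ^ m * (S + (-1) ^ h * (fact h * real (C h)))"
    using q by (simp add: field_simps)
  \<comment> \<open>Both exponents equal \<open>m * h\<close>; splitting off \<open>q ^ m\<close>
    lets it cancel against the factor on the other side.\<close>
  also have "real q ^ ((m - 1) * h) * real q ^ h = real q ^ m * real q ^ (m * (h - 1))"
    using assms(3) h by (cases m) (auto simp: k algebra_simps simp flip: power_add)
  finally have "(real q ^ m - 1) * real q ^ (m * (h - 1)) = S + (-1) ^ h * (fact h * real (C h))"
    using q by (simp add: mult.left_commute)
  then have "fact h * real (C h) = (-1) ^ h * ((real q ^ m - 1) * real q ^ (m * (h - 1)) - S)"
    by (simp flip: mult.assoc power_add)
  also have "\<dots> = (-1) ^ h * real q ^ (m * (h - 1)) * (real q ^ m - 1) + (-1) ^ k * S"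
    by (simp add: k algebra_simps)
  \<comment> \<open>Since \<open>h = Suc k\<close>, the exponent \<open>h + i - 1\<close> is
    \<open>k + i\<close>, with no truncation even at \<open>i = 0\<close>.\<close>
  also have "(-1) ^ k * S = (\<Sum>i=0..h - 1. (-1) ^ (h + i - 1) * real (C i) * G i)"
    by (simp add: S_def k sum_distrib_left power_add mult_ac)
  finally show "fact h * real (C h) =
      (-1) ^ h * real q ^ (m * (h - 1)) * (real q ^ m - 1) +
      (\<Sum>i = 0..h - 1. (-1) ^ (h + i - 1) * real (C i) *
        (\<Sum>t = i..h. fact t * stirling2 h t * real q ^ (h - t) * (real q - 1) ^ (t - i) *
          real ((n - i) choose (n - t))))"
    unfolding G_def .
qed

end
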